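(* Let $E=(0,\infty)$, let $\psi(x):=x$ for $x\in(0,\infty)$, and let $T:\mathcal{M}_1^\psi\to(0,\infty)$ be the unique maximum likelihood functional for the family $\{{\rm Exp}_\theta:\theta\in(0,\infty)\}$ of all exponential distributions. Then the sequence of maximum likelihood estimators $(\widehat T_n)$, $\widehat T_n(\boldsymbol{x}):=T(\frac1n\sum_{i=1}^n\delta_{x_i})$ for $\boldsymbol{x}=(x_1,x_2,\ldots)\in(0,\infty)^{\mathbb{N}}$, is robust on the class $\Gamma$ of all Gamma distributions with location parameter $0$.
   Context: ${\rm Exp}_\theta$ is the probability measure on $(0,\infty)$ with Lebesgue density $f_\theta(x)=e^{-x/\theta}/\theta$, $\theta>0$. $\Gamma$ is the class of all Borel probability measures on $(0,\infty)$ with Lebesgue density $f_{\kappa,\theta}(x)=x^{\kappa-1}e^{-x/\theta}/(\theta^\kappa\,\Gamma(\kappa))$ for some $\theta,\kappa>0$ (where $\Gamma(\kappa)$ in the density is the Gamma function). $\mathcal{M}_1^\psi$ is the set of all Borel probability measures $\mu$ on $(0,\infty)$ with $\int x\,\mu(dx)<\infty$. A maximum likelihood functional on $\mathcal{M}_1^\psi$ is a map $T$ with $T(\mu)\in\arg\max_{\theta\in(0,\infty)}\int\log f_\theta\,d\mu$ for all $\mu\in\mathcal{M}_1^\psi$; the maximizer is unique for each $\mu$, namely $\int x\,\mu(dx)$. Robustness: for a Borel probability measure $\mu$ on $E$ let $\mathbb{P}^\mu:=\mu^{\otimes\mathbb{N}}$ on $E^{\mathbb{N}}$. The state space $\Sigma=(0,\infty)$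 is equipped with a complete metric inducing its usual topology, and $\pi$ is the corresponding Prohorov metric on the Borel probability measures on $\Sigma$. The sequence $(\widehat T_n)$ is robust on a set $M$ of Borel probability measures on $E$ if for every $\mu\in M$ and $\varepsilon>0$ there is an open neighborhood $U$ of $\mu$ for the relative weak topology on $M$ such that $\pi(\mathbb{P}^\mu\circ\widehat T_n^{-1},\mathbb{P}^\nu\circ\widehat T_n^{-1})\le\varepsilon$ for all $\nu\in U$ and all $n\in\mathbb{N}$. *)

theory Defs
  imports "HOL-Probability.Probability"
begin

definition borel_probs :: "'a::topological_space set \<Rightarrow> 'a measure set" where
  "borel_probs E = {\<mu>. prob_space \<mu> \<and> sets \<mu> = sets (restrict_space borel E)}"

text \<open>The coarsest topology on the Borel probability measures on \<open>E\<close> that makes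
  integration of every bounded continuous function on \<open>E\<close> continuous.\<close>

definition weak_topology :: "'a::topological_space set \<Rightarrow> 'a measure topology" where
  "weak_topology E = topology_generated_by
     {{\<mu> \<in> borel_probs E. (\<integral>x. f x \<partial>\<mu>) \<in> V} | (f :: 'a \<Rightarrow> real) V.
        continuous_on E f \<and> bounded (f ` E) \<and> open V}"

text \<open>The Prohorov metric for a metric \<open>d\<close> on \<open>S\<close>, with \<open>A\<close> compared to its open
  \<open>\<epsilon>\<close>-neighbourhood.\<close>

definition prohorov ::
    "'a::topological_space set \<Rightarrow> ('a \<Rightarrow> 'a \<Rightarrow> real) \<Rightarrow> 'a measure \<Rightarrow> 'a measure \<Rightarrow> real" where
  "prohorov S d \<mu> \<nu> = Inf {\<epsilon>. \<epsilon> > 0 \<and> (\<forall>A \<in> sets (restrict_space borel S).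
      measure \<mu> A \<le> measure \<nu> {s \<in> S. \<exists>a\<in>A. d a s < \<epsilon>} + \<epsilon> \<and>
      measure \<nu> A \<le> measure \<mu> {s \<in> S. \<exists>a\<in>A. d a s < \<epsilon>} + \<epsilon>)}"

text \<open>Sequences are indexed from \<open>0\<close>, so the first \<open>n\<close> observations are
  \<open>x 0, \<dots>, x (n - 1)\<close>. Sample sizes are \<open>n \<ge> 1\<close>.\<close>

definition empirical_measure ::
    "'a::topological_space set \<Rightarrow> nat \<Rightarrow> (nat \<Rightarrow> 'a) \<Rightarrow> 'a measure" where
  "empirical_measure E n x = measure_of E (sets (restrict_space borel E))
     (\<lambda>A. (\<Sum>i<n. emeasure (return (restrict_space borel E) (x i)) A) / of_nat n)"

text \<open>\<open>Tn n\<close> is the estimator at sample size \<open>n\<close>, with values in \<open>S\<close>; \<open>d\<close> is the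
  metric on \<open>S\<close>. The product measure \<open>PiM UNIV (\<lambda>_. \<mu>)\<close> lives on the sequences in \<open>E\<close>.
  The notion is intended for measurable estimators.\<close>

definition robust_on ::
    "'a::topological_space set \<Rightarrow> 'b::topological_space set \<Rightarrow> ('b \<Rightarrow> 'b \<Rightarrow> real) \<Rightarrow>
     'a measure set \<Rightarrow> (nat \<Rightarrow> (nat \<Rightarrow> 'a) \<Rightarrow> 'b) \<Rightarrow> bool" where
  "robust_on E S d M Tn \<longleftrightarrow>
     (\<forall>\<mu>\<in>M. \<forall>\<epsilon>>0. \<exists>U. openin (subtopology (weak_topology E) M) U \<and> \<mu> \<in> U \<and>
        (\<forall>\<nu>\<in>U. \<forall>n\<ge>1.
           prohorov S d
             (distr (PiM (UNIV :: nat set) (\<lambda>_. \<mu>)) (restrict_space borel S) (Tn n))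
             (distr (PiM (UNIV :: nat set) (\<lambda>_. \<nu>)) (restrict_space borel S) (Tn n)) \<le> \<epsilon>))"

definition M1 :: "'a::topological_space set \<Rightarrow> ('a \<Rightarrow> real) \<Rightarrow> 'a measure set" where
  "M1 E \<psi> = {\<mu> \<in> borel_probs E. (\<integral>\<^sup>+x. ennreal (\<psi> x) \<partial>\<mu>) < \<infinity>}"

text \<open>Intended for families \<open>f\<close> whose log-densities are integrable with respect to every
  measure in \<open>M\<close>, since the Bochner integral of a non-integrable function is \<open>0\<close>.
  Values of \<open>T\<close> outside \<open>M\<close> are unconstrained.\<close>

definition maximum_likelihood_functional ::
    "'a measure set \<Rightarrow> 'p set \<Rightarrow> ('p \<Rightarrow> 'a \<Rightarrow> real) \<Rightarrow> ('a measure \<Rightarrow> 'p) \<Rightarrow> bool" where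
  "maximum_likelihood_functional M \<Theta> f T \<longleftrightarrow>
     (\<forall>\<mu>\<in>M. is_arg_max (\<lambda>\<theta>. \<integral>x. ln (f \<theta> x) \<partial>\<mu>) (\<lambda>\<theta>. \<theta> \<in> \<Theta>) (T \<mu>))"

definition exp_dens :: "real \<Rightarrow> real \<Rightarrow> real" where
  "exp_dens \<theta> x = exp (- x / \<theta>) / \<theta>"

definition gamma_dens :: "real \<Rightarrow> real \<Rightarrow> real \<Rightarrow> real" where
  "gamma_dens \<kappa> \<theta> x = x powr (\<kappa> - 1) * exp (- x / \<theta>) / (\<theta> powr \<kappa> * Gamma \<kappa>)"

definition gamma_class :: "real measure set" where
  "gamma_class = {\<mu> \<in> borel_probs {0<..}. \<exists>\<kappa>>0. \<exists>\<theta>>0.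
     \<mu> = density (restrict_space lborel {0<..}) (\<lambda>x. ennreal (gamma_dens \<kappa> \<theta> x))}"

text \<open>On the measures with finite first moment, the maximum likelihood functional of the
  exponential family exists and is unique: it is the mean.\<close>

lemma maximum_likelihood_functional_exp_iff:
  "maximum_likelihood_functional (M1 {0<..} (\<lambda>x. x)) {0<..} exp_dens T \<longleftrightarrow>
     (\<forall>\<mu> \<in> M1 {0<..} (\<lambda>x. x). T \<mu> = (\<integral>x. x \<partial>\<mu>))"
proof -
  have "is_arg_max (\<lambda>\<theta>. \<integral>x. ln (exp_dens \<theta> x) \<partial>\<mu>) (\<lambda>\<theta>. \<theta> \<in> {0<..}) t \<longleftrightarrow> t = (\<integral>x. x \<partial>\<mu>)"
    if \<mu>: "\<mu> \<in> M1 {0<..} (\<lambda>x. x)" for \<mu> t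
  proof -
    define m where "m = (\<integral>x. x \<partial>\<mu>)"
    from \<mu> have P: "prob_space \<mu>" and S: "sets \<mu> = sets (restrict_space borel {0<..})"
      and fin: "(\<integral>\<^sup>+x. ennreal x \<partial>\<mu>) < \<infinity>"
      by (auto simp: M1_def borel_probs_def)
    interpret prob_space \<mu> by (fact P)
    have space: "space \<mu> = {0<..}"
      using sets_eq_imp_space_eq[OF S] by (simp add: space_restrict_space)
    have meas: "(\<lambda>x. x) \<in> borel_measurable \<mu>"
      unfolding measurable_cong_sets[OF S refl] by (intro measurable_restrict_space1) simp
    have int: "integrable \<mu> (\<lambda>x. x)"
      by (rule integrableI_nonneg[OF meas]) (auto simp: space fin[simplified] intro!: AE_I2)
    have "m \<ge> 0"
      unfolding m_def by (intro integral_nonneg_AE AE_I2) (simp add: space)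
    moreover have "m \<noteq> 0"
    proof
      assume "m = 0"
      moreover have "AE x in \<mu>. 0 \<le> x"
        by (rule AE_I2) (simp add: space)
      ultimately have "AE x in \<mu>. x = 0"
        using integral_nonneg_eq_0_iff_AE[OF int] by (simp add: m_def)
      moreover have "AE x in \<mu>. x \<noteq> 0"
        by (rule AE_I2) (simp add: space)
      ultimately have "AE x in \<mu>. False"
        by eventually_elim simp
      then show False by simp
    qed
    ultimately have m: "m > 0" by simp
    have L: "(\<integral>x. ln (exp_dens \<theta> x) \<partial>\<mu>) = - m / \<theta> - ln \<theta>" if "\<theta> > 0" for \<theta>
    proof -
      have "(\<integral>x. ln (exp_dens \<theta> x) \<partial>\<mu>) = (\<integral>x. (- 1 / \<theta>) * x - ln \<theta> \<partial>\<mu>)"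
        using that by (intro Bochner_Integration.integral_cong) (simp_all add: exp_dens_def ln_div)
      also have "\<dots> = (- 1 / \<theta>) * m - ln \<theta>"
        unfolding m_def using int by (simp add: prob_space)
      finally show ?thesis by simp
    qed
    have lt: "- m / \<theta> - ln \<theta> < - m / m - ln m" if "\<theta> > 0" "\<theta> \<noteq> m" for \<theta>
    proof -
      have "ln (m / \<theta>) \<le> m / \<theta> - 1"
        using that m by (intro ln_le_minus_one) auto
      moreover have "ln (m / \<theta>) \<noteq> m / \<theta> - 1"
        using that m ln_eq_minus_one[of "m / \<theta>"] by auto
      ultimately show ?thesis using that m by (simp add: ln_div)
    qed
    show ?thesis
    proof
      assume "is_arg_max (\<lambda>\<theta>. \<integral>x. ln (exp_dens \<theta> x) \<partial>\<mu>) (\<lambda>\<theta>. \<theta> \<in> {0<..}) t"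
      then have "t > 0" "\<not> - m / t - ln t < - m / m - ln m"
        using m L unfolding is_arg_max_def by auto
      then show "t = (\<integral>x. x \<partial>\<mu>)" using lt m_def by blast
    next
      assume "t = (\<integral>x. x \<partial>\<mu>)"
      then have t: "t = m" by (simp add: m_def)
      have "\<not> - m / m - ln m < - m / \<theta> - ln \<theta>" if "\<theta> > 0" for \<theta>
        using lt[OF that] by (cases "\<theta> = m") auto
      then show "is_arg_max (\<lambda>\<theta>. \<integral>x. ln (exp_dens \<theta> x) \<partial>\<mu>) (\<lambda>\<theta>. \<theta> \<in> {0<..}) t"
        unfolding is_arg_max_def t using m by (auto simp: L)
    qed
  qed
  then show ?thesis unfolding maximum_likelihood_functional_def by blast
qed

end

theory Submission
  imports Defs
begin

text \<open>The estimator is the sample mean. If \<open>X\<close>, \<open>Y\<close> are coupled with laws \<open>\<mu>\<close>, \<open>\<nu>\<close>,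
  independent copies of the pair couple the two laws of the sample mean, and for every sample
  size the expected distance of the two means is at most the expectation of \<open>\<bar>X - Y\<bar>\<close>. Together
  with tightness of the means in the open half-line, uniformly in the sample size, this bounds
  the Prohorov distance for every metric inducing the usual topology. It remains to find couplings
  with small expected distance for \<open>\<nu>\<close> weakly close to \<open>\<mu>\<close> in the Gamma class. The integrals of the three
  bounded functions \<open>x\<^sup>j e\<^sup>-\<^sup>x\<close>, \<open>j = 0, 1, 2\<close>, determine the Gamma parameters continuously;
  convergence of the parameters gives convergence in law and of the means, so that Skorohod's
  theorem followed by Scheffe's lemma provides the couplings.\<close>

subsection \<open>Sample means\<close>

abbreviation pos_borel :: "real measure" where
  "pos_borel \<equiv> restrict_space borel {0<..}"

text \<open>Closed form of the estimator for sample sizes \<open>n \<ge> 1\<close>. At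
  \<open>n = 0\<close> division by zero yields \<open>0\<close>, which lies outside the
  half-line.\<close>

definition sample_mean :: "nat \<Rightarrow> (nat \<Rightarrow> real) \<Rightarrow> real" where
  "sample_mean n x = (\<Sum>i<n. x i) / real n"

lemma sample_mean_pos: "n \<ge> 1 \<Longrightarrow> (\<And>i. x i > 0) \<Longrightarrow> sample_mean n x > 0"
  unfolding sample_mean_def by (intro divide_pos_pos sum_pos) (auto simp: lessThan_empty_iff)

text \<open>Drawing an index uniformly and reading off the observation produces the empirical
  measure. As an image measure it is countably additive, so \<open>measure_of\<close> keeps the
  prescribed set function, and integrals against it become finite averages.\<close>

lemma empirical_measure_eq_distr:
  assumes "n \<ge> 1" and x: "\<And>i. x i \<in> E"
  shows "empirical_measure E n x =
    distr (uniform_count_measure {..<n}) (restrict_space borel E) x" (is "_ = ?D")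
proof -
  have sp: "space (restrict_space borel E) = E" by (simp add: space_restrict_space)
  have meas: "x \<in> measurable (uniform_count_measure {..<n}) (restrict_space borel E)"
    by (auto simp: measurable_def space_uniform_count_measure sets_uniform_count_measure sp x)
  have "(\<Sum>i<n. emeasure (return (restrict_space borel E) (x i)) A) / of_nat n = emeasure ?D A"
    if A: "A \<in> sets (restrict_space borel E)" for A
  proof -
    have "(\<Sum>i<n. emeasure (return (restrict_space borel E) (x i)) A) = (\<Sum>i<n. indicator A (x i))"
      using A by simp
    also have "\<dots> = (\<Sum>i<n. of_bool (x i \<in> A))"
      by (intro sum.cong) (auto simp: indicator_def)
    also have "\<dots> = of_nat (card {i. i < n \<and> x i \<in> A})"
      by (simp add: sum_of_bool_eq Int_def)
    finally have "(\<Sum>i<n. emeasure (return (restrict_space borel E) (x i)) A) / of_nat n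
      = of_nat (card {i. i < n \<and> x i \<in> A}) / of_nat n" by simp
    also have "\<dots> = ennreal (card {i. i < n \<and> x i \<in> A} / n)"
      using assms(1) by (simp add: ennreal_of_nat_eq_real_of_nat divide_ennreal)
    also have "\<dots> = emeasure ?D A"
    proof -
      have "x -` A \<inter> space (uniform_count_measure {..<n}) = {i. i < n \<and> x i \<in> A}"
        by (auto simp: space_uniform_count_measure)
      moreover have "{i. i < n \<and> x i \<in> A} \<subseteq> {..<n}" by auto
      ultimately show ?thesis
        using A meas by (simp add: emeasure_distr emeasure_uniform_count_measure)
    qed
    finally show ?thesis .
  qed
  then have "empirical_measure E n x = measure_of E (sets (restrict_space borel E)) (emeasure ?D)"
    unfolding empirical_measure_def using sets.sigma_sets_eq[of "restrict_space borel E"]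
    by (intro measure_of_eq) (use sets.space_closed[of "restrict_space borel E"] sp in auto)
  also have "\<dots> = ?D"
    using measure_of_of_measure[of ?D] sp by simp
  finally show ?thesis .
qed

text \<open>An empirical measure has a finite first moment, so it belongs to the class on which the
  functional is forced to be the mean.\<close>

lemma mle_exp_empirical:
  assumes T: "maximum_likelihood_functional (M1 {0<..} (\<lambda>x. x)) {0<..} exp_dens T"
    and n: "n \<ge> 1" and x: "\<And>i. x i > 0"
  shows "T (empirical_measure {0<..} n x) = sample_mean n x"
proof -
  let ?U = "uniform_count_measure {..<n}"
  let ?D = "empirical_measure {0<..} n x"
  have eq: "?D = distr ?U pos_borel x"
    using n x by (intro empirical_measure_eq_distr) auto
  interpret U: prob_space ?U
    using n by (intro prob_space_uniform_count_measure) (auto simp: lessThan_empty_iff)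
  have meas: "x \<in> measurable ?U pos_borel"
    by (auto simp: measurable_def space_uniform_count_measure sets_uniform_count_measure
      space_restrict_space x)
  have "(\<integral>\<^sup>+y. ennreal y \<partial>?D) = (\<integral>\<^sup>+i. ennreal (x i) \<partial>?U)"
    unfolding eq using meas by (subst nn_integral_distr) (auto intro!: measurable_restrict_space1)
  also have "\<dots> < \<infinity>"
    unfolding uniform_count_measure_def by (subst nn_integral_point_measure_finite)
      (auto simp: ennreal_mult_less_top)
  finally have "?D \<in> M1 {0<..} (\<lambda>x. x)"
    using U.prob_space_distr[OF meas] by (simp add: M1_def borel_probs_def eq)
  then have "T ?D = (\<integral>y. y \<partial>?D)"
    using T maximum_likelihood_functional_exp_iff by blast
  also have "\<dots> = (\<integral>i. x i \<partial>?U)"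
    unfolding eq by (intro integral_distr meas measurable_restrict_space1) simp
  also have "\<dots> = sample_mean n x"
    by (simp add: integral_uniform_count_measure sample_mean_def)
  finally show ?thesis .
qed

text \<open>Applying \<open>X\<close> coordinatewise to an independent sequence gives an independent
  sequence with the law of \<open>X\<close>, because both measures agree on finite-dimensional
  cylinders. This realises the samples of all coupled variables on one product space.\<close>

lemma distr_PiM_componentwise:
  assumes "prob_space \<Omega>" and X[measurable]: "X \<in> measurable \<Omega> N"
  shows "distr (PiM UNIV (\<lambda>_::nat. \<Omega>)) (PiM UNIV (\<lambda>_. N)) (\<lambda>\<omega> i. X (\<omega> i)) =
    PiM UNIV (\<lambda>_. distr \<Omega> N X)"
proof -
  interpret prob_space \<Omega> by fact
  let ?P = "PiM UNIV (\<lambda>_::nat. \<Omega>)"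
  have D: "distr ?P N (\<lambda>\<omega>. X (\<omega> i)) = distr \<Omega> N X" for i
  proof -
    have "distr ?P \<Omega> (\<lambda>\<omega>. \<omega> i) = \<Omega>"
      using distr_PiM_component[of UNIV "\<lambda>_. \<Omega>" i] assms(1) by simp
    then show ?thesis using distr_distr[of X \<Omega> N "\<lambda>\<omega>. \<omega> i" ?P] by (simp add: comp_def)
  qed
  show ?thesis
  proof (rule measure_eqI_PiM_infinite)
    interpret P: prob_space ?P by (intro prob_space_PiM) (rule assms(1))
    have [measurable]: "(\<lambda>\<omega> i. X (\<omega> i)) \<in> measurable ?P (PiM UNIV (\<lambda>_. N))"
      by (rule measurable_PiM_single') (auto simp: space_PiM dest: measurable_space[OF X])
    show "finite_measure (distr ?P (PiM UNIV (\<lambda>_. N)) (\<lambda>\<omega> i. X (\<omega> i)))"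
      by (intro P.finite_measure_distr) measurable
    fix J and A :: "nat \<Rightarrow> _" assume J: "finite J" and A: "\<And>i. i \<in> J \<Longrightarrow> A i \<in> sets N"
    have emb: "prod_emb UNIV (\<lambda>_. N) J (Pi\<^sub>E J A) \<in> sets (PiM UNIV (\<lambda>_. N))"
      using J A by (intro sets_PiM_I) auto
    \<comment> \<open>The preimage of a cylinder is the cylinder over the preimages of its sides, so
      its probability is again a finite product.\<close>
    have "emeasure (distr ?P (PiM UNIV (\<lambda>_. N)) (\<lambda>\<omega> i. X (\<omega> i))) (prod_emb UNIV (\<lambda>_. N) J (Pi\<^sub>E J A))
      = emeasure ?P (prod_emb UNIV (\<lambda>_. \<Omega>) J (Pi\<^sub>E J (\<lambda>i. X -` A i \<inter> space \<Omega>)))"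
      using emb by (subst emeasure_distr)
        (auto intro!: arg_cong2[where f = emeasure] simp: prod_emb_def space_PiM PiE_iff Pi_iff
          dest: measurable_space[OF X])
    also have "\<dots> = (\<Prod>i\<in>J. emeasure \<Omega> (X -` A i \<inter> space \<Omega>))"
      using J A assms(1) by (intro emeasure_PiM_emb) auto
    also have "\<dots> = (\<Prod>i\<in>J. emeasure (distr \<Omega> N X) (A i))"
      using A by (intro prod.cong) (auto simp: emeasure_distr)
    also have "\<dots> = emeasure (PiM UNIV (\<lambda>_. distr \<Omega> N X)) (prod_emb UNIV (\<lambda>_. N) J (Pi\<^sub>E J A))"
      using J A emeasure_PiM_emb[of UNIV "\<lambda>_. distr \<Omega> N X" J A] prob_space_distr[OF X]
      by (simp add: prod_emb_def)
    finally show "emeasure (distr ?P (PiM UNIV (\<lambda>_. N)) (\<lambda>\<omega> i. X (\<omega> i))) (prod_emb UNIV (\<lambda>_. N) J (Pi\<^sub>E J A))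
      = emeasure (PiM UNIV (\<lambda>_. distr \<Omega> N X)) (prod_emb UNIV (\<lambda>_. N) J (Pi\<^sub>E J A))" .
  qed (auto intro!: sets_PiM_cong)
qed

text \<open>By linearity the sample mean has the expectation of a single observation, so Markov's
  inequality gives a bound free of \<open>n\<close>. All uniformity in the sample size comes from
  here.\<close>

lemma sample_mean_Markov:
  assumes "prob_space \<Omega>" and f: "integrable \<Omega> f" and f0: "\<And>x. x \<in> space \<Omega> \<Longrightarrow> 0 \<le> f x"
    and c: "c > 0" and n: "n \<ge> 1"
  shows "measure (PiM UNIV (\<lambda>_::nat. \<Omega>))
      {\<omega> \<in> space (PiM UNIV (\<lambda>_::nat. \<Omega>)). sample_mean n (\<lambda>i. f (\<omega> i)) \<ge> c} \<le> (\<integral>x. f x \<partial>\<Omega>) / c"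
proof -
  let ?P = "PiM UNIV (\<lambda>_::nat. \<Omega>)"
  note [measurable] = borel_measurable_integrable[OF f]
  have D: "distr ?P \<Omega> (\<lambda>\<omega>. \<omega> i) = \<Omega>" for i
    using distr_PiM_component[of UNIV "\<lambda>_. \<Omega>" i] assms(1) by simp
  have int: "integrable ?P (\<lambda>\<omega>. f (\<omega> i))" for i
    by (rule integrable_distr[where M' = \<Omega>]) (use f in \<open>simp_all add: D\<close>)
  have ex: "(\<integral>\<omega>. f (\<omega> i) \<partial>?P) = (\<integral>x. f x \<partial>\<Omega>)" for i
    using integral_distr[of "\<lambda>\<omega>. \<omega> i" ?P \<Omega> f] by (simp add: D)
  have "(\<integral>\<omega>. sample_mean n (\<lambda>i. f (\<omega> i)) \<partial>?P) = (\<integral>x. f x \<partial>\<Omega>)"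
    unfolding sample_mean_def using n by (simp add: int ex)
  moreover have "measure ?P {\<omega> \<in> space ?P. sample_mean n (\<lambda>i. f (\<omega> i)) \<ge> c}
     \<le> (\<integral>\<omega>. sample_mean n (\<lambda>i. f (\<omega> i)) \<partial>?P) / c"
  proof (rule integral_Markov_inequality_measure[OF _ sets.empty_sets])
    show "integrable ?P (\<lambda>\<omega>. sample_mean n (\<lambda>i. f (\<omega> i)))"
      unfolding sample_mean_def by (simp add: int)
    show "AE \<omega> in ?P. 0 \<le> sample_mean n (\<lambda>i. f (\<omega> i))"
      unfolding sample_mean_def
      by (auto intro!: AE_I2 divide_nonneg_nonneg sum_nonneg f0 simp: space_PiM PiE_iff)
  qed (rule c)
  ultimately show ?thesis by simp
qed

text \<open>Markov's inequality controls large means. For small means it is applied to the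
  proportion of small observations, which is itself the sample mean of an indicator.\<close>

lemma sample_mean_tight:
  assumes "prob_space \<Omega>" and X: "integrable \<Omega> X" and X0: "\<And>x. x \<in> space \<Omega> \<Longrightarrow> 0 < X x"
    and \<epsilon>: "\<epsilon> > 0"
  obtains a b where "0 < a"
    "\<And>n. n \<ge> 1 \<Longrightarrow> measure (PiM UNIV (\<lambda>_::nat. \<Omega>))
      {\<omega> \<in> space (PiM UNIV (\<lambda>_::nat. \<Omega>)). sample_mean n (\<lambda>i. X (\<omega> i)) \<notin> {a..b}} \<le> \<epsilon>"
proof -
  interpret prob_space \<Omega> by fact
  let ?P = "PiM UNIV (\<lambda>_::nat. \<Omega>)"
  interpret P: prob_space ?P by (intro prob_space_PiM) (rule assms(1))
  note [measurable] = borel_measurable_integrable[OF X]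
  \<comment> \<open>Since \<open>X > 0\<close>, these events decrease to the empty set. Probability
    below \<open>\<epsilon> / 4\<close> is requested because Markov's inequality at level
    \<open>1 / 2\<close> doubles it.\<close>
  define A where "A k = {x \<in> space \<Omega>. X x < 1 / Suc k}" for k
  have "(\<lambda>k. prob (A k)) \<longlonglongrightarrow> prob (\<Inter>k. A k)"
  proof (rule finite_Lim_measure_decseq)
    show "range A \<subseteq> events" by (auto simp: A_def)
    show "decseq A"
      by (rule decseq_SucI) (auto simp: A_def elim!: order.strict_trans2 intro!: divide_left_mono)
  qed
  moreover have "(\<Inter>k. A k) = {}"
  proof -
    have "\<exists>k. \<not> X x < 1 / Suc k" if "x \<in> space \<Omega>" for x
      using reals_Archimedean[OF X0[OF that]] by (auto simp: inverse_eq_divide not_less intro: less_imp_le)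
    then show ?thesis by (auto simp: A_def)
  qed
  ultimately have "(\<lambda>k. prob (A k)) \<longlonglongrightarrow> 0" by simp
  then have "eventually (\<lambda>k. prob (A k) < \<epsilon> / 4) sequentially"
    using \<epsilon> by (intro order_tendstoD(2)[of _ 0]) auto
  then obtain k where k: "prob (A k) < \<epsilon> / 4" by (auto simp: eventually_sequentially)
  have Ak[measurable]: "A k \<in> events" by (simp add: A_def)
  define c where "c = 1 / real (Suc k)"
  have c: "c > 0" by (simp add: c_def)
  define m where "m = (\<integral>x. X x \<partial>\<Omega>)"
  have m: "m \<ge> 0" unfolding m_def by (intro integral_nonneg_AE AE_I2 less_imp_le X0)
  \<comment> \<open>Chosen so that \<open>m / b \<le> \<epsilon> / 2\<close>; the summand 1 keeps
    \<open>b\<close> positive when only \<open>m \<ge> 0\<close> is known.\<close>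
  define b where "b = 2 * (m + 1) / \<epsilon>"
  have b: "b > 0" using m \<epsilon> by (simp add: b_def)
  show ?thesis
  proof (rule that[of "c / 2" b])
    fix n :: nat assume n: "n \<ge> 1"
    let ?S = "\<lambda>f. sample_mean n f"
    let ?B1 = "{\<omega> \<in> space ?P. ?S (\<lambda>i. indicator (A k) (\<omega> i)) \<ge> 1 / 2}"
    let ?B2 = "{\<omega> \<in> space ?P. ?S (\<lambda>i. X (\<omega> i)) \<ge> b}"
    have [measurable]: "?B1 \<in> P.events" "?B2 \<in> P.events"
      unfolding sample_mean_def by measurable
    have "P.prob ?B1 \<le> (\<integral>x. indicator (A k) x \<partial>\<Omega>) / (1 / 2)"
      by (rule sample_mean_Markov) (use assms(1) n Ak in \<open>auto simp: emeasure_eq_measure\<close>)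
    also have "\<dots> \<le> \<epsilon> / 2" using k by simp
    finally have 1: "P.prob ?B1 \<le> \<epsilon> / 2" .
    have "P.prob ?B2 \<le> m / b"
      unfolding m_def by (rule sample_mean_Markov) (use assms(1) n X b less_imp_le[OF X0] in auto)
    also have "\<dots> \<le> \<epsilon> / 2" using m \<epsilon> by (simp add: b_def field_simps)
    finally have 2: "P.prob ?B2 \<le> \<epsilon> / 2" .
    \<comment> \<open>A mean below \<open>c / 2\<close> forces at least half of the observations below \<open>c\<close>.\<close>
    have "{\<omega> \<in> space ?P. ?S (\<lambda>i. X (\<omega> i)) \<notin> {c / 2..b}} \<subseteq> ?B1 \<union> ?B2"
    proof (intro subsetI, rule ccontr)
      fix \<omega> assume \<omega>: "\<omega> \<in> {\<omega> \<in> space ?P. ?S (\<lambda>i. X (\<omega> i)) \<notin> {c / 2..b}}"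
        and not: "\<omega> \<notin> ?B1 \<union> ?B2"
      have mem: "\<omega> i \<in> space \<Omega>" for i using \<omega> by (auto simp: space_PiM)
      \<comment> \<open>Observations outside \<open>A k\<close> are at least \<open>c\<close>, the
        others at least 0. Averaging bounds the mean below by \<open>c\<close> times the proportion
        of observations outside \<open>A k\<close>.\<close>
      have "c * (1 - indicator (A k) (\<omega> i)) \<le> X (\<omega> i)" for i
        using mem[of i] X0[OF mem[of i]] by (auto simp: A_def c_def indicator_def)
      then have "(\<Sum>i<n. c * (1 - indicator (A k) (\<omega> i))) \<le> (\<Sum>i<n. X (\<omega> i))"
        by (intro sum_mono)
      then have "(\<Sum>i<n. c * (1 - indicator (A k) (\<omega> i))) / n \<le> ?S (\<lambda>i. X (\<omega> i))"
        unfolding sample_mean_def by (intro divide_right_mono) auto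
      moreover have "(\<Sum>i<n. c * (1 - indicator (A k) (\<omega> i))) / n
          = c * (1 - ?S (\<lambda>i. indicator (A k) (\<omega> i)))"
        using n by (simp add: sample_mean_def sum_subtractf field_simps flip: sum_distrib_left)
      moreover have "?S (\<lambda>i. indicator (A k) (\<omega> i)) < 1 / 2" "?S (\<lambda>i. X (\<omega> i)) < b"
        using not \<omega> by auto
      moreover have "c * (1 / 2) \<le> c * (1 - ?S (\<lambda>i. indicator (A k) (\<omega> i)))"
        using calculation(3) c by (intro mult_left_mono) auto
      ultimately show False using \<omega> by auto
    qed
    then have "P.prob {\<omega> \<in> space ?P. ?S (\<lambda>i. X (\<omega> i)) \<notin> {c / 2..b}} \<le> P.prob (?B1 \<union> ?B2)"
      using \<open>?B1 \<in> P.events\<close> \<open>?B2 \<in> P.events\<close> by (intro P.finite_measure_mono sets.Un)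
    also have "\<dots> \<le> P.prob ?B1 + P.prob ?B2"
      by (intro measure_Un_le) fact+
    finally show "P.prob {\<omega> \<in> space ?P. ?S (\<lambda>i. X (\<omega> i)) \<notin> {c / 2..b}} \<le> \<epsilon>"
      using 1 2 by simp
  qed (use c in simp)
qed

subsection \<open>Gamma distributions\<close>

text \<open>For nonnegative functions the norm is the function itself, so convergence of the
  integrals is convergence of the norms, as Scheffe's lemma requires. It serves once for densities
  and once for coupled random variables.\<close>

lemma Scheffe_integral:
  fixes F :: "nat \<Rightarrow> 'a \<Rightarrow> real"
  assumes F: "\<And>n. integrable M (F n)" and f: "integrable M f"
    and F0: "\<And>n x. x \<in> space M \<Longrightarrow> 0 \<le> F n x" and f0: "\<And>x. x \<in> space M \<Longrightarrow> 0 \<le> f x"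
    and lim: "AE x in M. (\<lambda>n. F n x) \<longlonglongrightarrow> f x"
    and conv: "(\<lambda>n. \<integral>x. F n x \<partial>M) \<longlonglongrightarrow> (\<integral>x. f x \<partial>M)"
  shows "(\<lambda>n. \<integral>x. \<bar>F n x - f x\<bar> \<partial>M) \<longlonglongrightarrow> 0"
proof -
  have nnF: "(\<integral>\<^sup>+x. norm (F n x) \<partial>M) = ennreal (\<integral>x. F n x \<partial>M)" for n
    using nn_integral_eq_integral[OF F[of n]] F0
    by (simp cong: nn_integral_cong_simp)
  have nnf: "(\<integral>\<^sup>+x. norm (f x) \<partial>M) = ennreal (\<integral>x. f x \<partial>M)"
    using nn_integral_eq_integral[OF f] f0
    by (simp cong: nn_integral_cong_simp)
  have "(\<lambda>n. \<integral>\<^sup>+x. norm (F n x - f x) \<partial>M) \<longlonglongrightarrow> 0"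
  proof (rule Scheffe_lemma1[OF F f lim])
    have "(\<lambda>n. \<integral>\<^sup>+x. norm (F n x) \<partial>M) \<longlonglongrightarrow> (\<integral>\<^sup>+x. norm (f x) \<partial>M)"
      unfolding nnF nnf by (intro tendsto_ennrealI conv)
    then show "limsup (\<lambda>n. \<integral>\<^sup>+x. norm (F n x) \<partial>M) \<le> (\<integral>\<^sup>+x. norm (f x) \<partial>M)"
      by (simp add: lim_imp_Limsup)
  qed
  moreover have "(\<integral>\<^sup>+x. norm (F n x - f x) \<partial>M) = ennreal (\<integral>x. \<bar>F n x - f x\<bar> \<partial>M)" for n
    using nn_integral_eq_integral[of M "\<lambda>x. \<bar>F n x - f x\<bar>"] F f by simp
  ultimately have "(\<lambda>n. ennreal (\<integral>x. \<bar>F n x - f x\<bar> \<partial>M)) \<longlonglongrightarrow> ennreal 0" by simp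
  then show ?thesis
    by (subst (asm) tendsto_ennreal_iff) (auto intro!: always_eventually)
qed

text \<open>Substituting \<open>t * x\<close> for \<open>x\<close> turns this into Euler's integral
  for the Gamma function; the Jacobian \<open>t\<close> and the factor \<open>t powr (a - 1)\<close>
  combine to \<open>t powr a\<close>.\<close>

lemma has_bochner_integral_Gamma_scaled:
  fixes a t :: real
  assumes a: "a > 0" and t: "t > 0"
  shows "has_bochner_integral lborel
    (\<lambda>x. indicator {0<..} x * (x powr (a - 1) * exp (- x / t))) (t powr a * Gamma a)"
proof (rule has_bochner_integral_nn_integral)
  let ?h = "\<lambda>x. indicator {0<..} x * (x powr (a - 1) * exp (- x / t))"
  have "(\<integral>\<^sup>+x. ennreal (?h x) \<partial>lborel) = t * (\<integral>\<^sup>+x. ennreal (?h (0 + t * x)) \<partial>lborel)"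
    using t by (subst nn_integral_real_affine[where c = t and t = 0]) auto
  also have "(\<integral>\<^sup>+x. ennreal (?h (0 + t * x)) \<partial>lborel) =
    (\<integral>\<^sup>+x. ennreal (t powr (a - 1)) * ennreal (indicator {0..} x * x powr (a - 1) / exp x) \<partial>lborel)"
  \<comment> \<open>Euler's integral runs over the closed half-line; the endpoint 0 is discarded as
    a null set.\<close>
  proof (rule nn_integral_cong_AE, rule AE_mp[OF AE_lborel_singleton[of 0]], intro AE_I2 impI)
    fix x :: real assume "x \<noteq> 0"
    then have "?h (0 + t * x) = t powr (a - 1) * (indicator {0..} x * x powr (a - 1) / exp x)"
      using t by (auto simp: indicator_def zero_less_mult_iff powr_mult exp_minus field_simps)
    then show "ennreal (?h (0 + t * x)) =
      ennreal (t powr (a - 1)) * ennreal (indicator {0..} x * x powr (a - 1) / exp x)"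
      by (simp only: ennreal_mult' powr_ge_zero)
  qed
  also have "\<dots> = ennreal (t powr (a - 1)) * ennreal (Gamma a)"
    unfolding Gamma_conv_nn_integral_real[OF a] by (rule nn_integral_cmult) simp
  also have "ennreal t * \<dots> = ennreal (t powr a * Gamma a)"
  proof -
    have "t powr a * Gamma a = t * (t powr (a - 1) * Gamma a)"
      using t powr_mult_base[of t "a - 1"] by simp
    moreover have "Gamma a \<ge> 0" using Gamma_real_pos[OF a] by simp
    ultimately show ?thesis using t by (simp only: ennreal_mult powr_ge_zero mult_nonneg_nonneg less_imp_le)
  qed
  finally show "(\<integral>\<^sup>+x. ennreal (?h x) \<partial>lborel) = ennreal (t powr a * Gamma a)" .
next
  show "0 \<le> t powr a * Gamma a" using Gamma_real_pos[OF a] by simp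
qed (simp_all add: indicator_def)

section \<open>Gamma laws on the real line and their exponentially weighted moments\<close>

definition gamma_dens0 :: "real \<Rightarrow> real \<Rightarrow> real \<Rightarrow> real" where
  "gamma_dens0 \<kappa> \<theta> x = indicator {0<..} x * gamma_dens \<kappa> \<theta> x"

text \<open>The law is placed on the whole line, with density extended by zero, because
  \<open>weak_conv_m\<close> and Skorohod's theorem concern real distributions.\<close>

definition gamma_distr :: "real \<Rightarrow> real \<Rightarrow> real measure" where
  "gamma_distr \<kappa> \<theta> = density lborel (\<lambda>x. ennreal (gamma_dens0 \<kappa> \<theta> x))"

lemma borel_measurable_gamma_dens [measurable]: "gamma_dens \<kappa> \<theta> \<in> borel_measurable borel"
  unfolding gamma_dens_def[abs_def] by measurable

lemma borel_measurable_gamma_dens0 [measurable]: "gamma_dens0 \<kappa> \<theta> \<in> borel_measurable borel"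
  unfolding gamma_dens0_def[abs_def] by measurable

lemma sets_gamma_distr [simp, measurable_cong]: "sets (gamma_distr \<kappa> \<theta>) = sets borel"
  by (simp add: gamma_distr_def)

lemma gamma_dens0_nonneg: "\<kappa> > 0 \<Longrightarrow> 0 \<le> gamma_dens0 \<kappa> \<theta> x"
  by (auto simp: gamma_dens0_def gamma_dens_def indicator_def intro!: divide_nonneg_nonneg mult_nonneg_nonneg)

text \<open>The weight \<open>x ^ j * exp (- (s * x))\<close> turns the density into an unnormalised
  Gamma density of shape \<open>\<kappa> + j\<close> and scale \<open>q\<close> with
  \<open>1 / q = 1 / \<theta> + s\<close>; the value is a quotient of normalising constants. Taking
  \<open>s = 0\<close> gives total mass and mean, \<open>s = 1\<close> the bounded test
  functions.\<close>

lemma gamma_dens0_moment: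
  assumes \<kappa>: "\<kappa> > 0" and \<theta>: "\<theta> > 0" and s: "s \<ge> 0"
  shows "has_bochner_integral lborel (\<lambda>x. gamma_dens0 \<kappa> \<theta> x * (x ^ j * exp (- (s * x))))
    (Gamma (\<kappa> + j) * (\<theta> / (1 + s * \<theta>)) powr (\<kappa> + j) / (Gamma \<kappa> * \<theta> powr \<kappa>))"
proof -
  define q where "q = \<theta> / (1 + s * \<theta>)"
  have pos: "1 + s * \<theta> > 0" using \<theta> s by (simp add: add_pos_nonneg)
  have q: "q > 0" using \<theta> pos by (simp add: q_def)
  have "has_bochner_integral lborel
     (\<lambda>x. 1 / (Gamma \<kappa> * \<theta> powr \<kappa>) * (indicator {0<..} x * (x powr (\<kappa> + j - 1) * exp (- x / q))))
     (1 / (Gamma \<kappa> * \<theta> powr \<kappa>) * (q powr (\<kappa> + j) * Gamma (\<kappa> + j)))"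
    by (intro has_bochner_integral_mult_right has_bochner_integral_Gamma_scaled) (use \<kappa> q in auto)
  moreover have "1 / (Gamma \<kappa> * \<theta> powr \<kappa>) * (indicator {0<..} x * (x powr (\<kappa> + j - 1) * exp (- x / q))) =
    gamma_dens0 \<kappa> \<theta> x * (x ^ j * exp (- (s * x)))" for x
  proof (cases "x > 0")
    case True
    have "x powr (\<kappa> + j - 1) = x powr (\<kappa> - 1) * x ^ j"
      using True by (simp add: powr_add[symmetric] powr_realpow[symmetric] algebra_simps)
    moreover have "- x / q = - x / \<theta> + - (s * x)"
      using \<theta> pos by (simp add: q_def field_simps)
    then have "exp (- x / q) = exp (- x / \<theta>) * exp (- (s * x))"
      by (simp only: exp_add)
    ultimately show ?thesis
      using True by (simp add: gamma_dens0_def gamma_dens_def mult_ac)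
  qed (simp add: gamma_dens0_def)
  ultimately show ?thesis by (simp add: q_def mult.commute)
qed

lemma gamma_distr_moment:
  assumes "\<kappa> > 0" "\<theta> > 0" "s \<ge> 0"
  shows "has_bochner_integral (gamma_distr \<kappa> \<theta>) (\<lambda>x. x ^ j * exp (- (s * x)))
    (Gamma (\<kappa> + j) * (\<theta> / (1 + s * \<theta>)) powr (\<kappa> + j) / (Gamma \<kappa> * \<theta> powr \<kappa>))"
  unfolding gamma_distr_def
  by (rule has_bochner_integral_density)
     (use gamma_dens0_moment[OF assms] gamma_dens0_nonneg[OF assms(1)] in auto)

lemma gamma_dens0_integral:
  assumes "\<kappa> > 0" "\<theta> > 0"
  shows "has_bochner_integral lborel (gamma_dens0 \<kappa> \<theta>) 1"
  using gamma_dens0_moment[OF assms, of 0 0] less_imp_neq[OF Gamma_real_pos[OF assms(1)]] assms by simp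

lemma gamma_distr_mean:
  assumes "\<kappa> > 0" "\<theta> > 0"
  shows "has_bochner_integral (gamma_distr \<kappa> \<theta>) (\<lambda>x. x) (\<kappa> * \<theta>)"
proof -
  have "\<kappa> \<notin> \<int>\<^sub>\<le>\<^sub>0" using assms by (auto elim!: nonpos_Ints_cases)
  then have "Gamma (\<kappa> + 1) * \<theta> powr (\<kappa> + 1) / (Gamma \<kappa> * \<theta> powr \<kappa>) = \<kappa> * \<theta>"
    using assms Gamma_plus1[of \<kappa>] by (simp add: powr_add Gamma_eq_zero_iff)
  then show ?thesis
    using gamma_distr_moment[OF assms, of 0 1] by simp
qed

lemma real_distribution_gamma:
  assumes "\<kappa> > 0" "\<theta> > 0"
  shows "real_distribution (gamma_distr \<kappa> \<theta>)"
proof -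
  have "(\<integral>\<^sup>+x. ennreal (gamma_dens0 \<kappa> \<theta> x) \<partial>lborel) = 1"
    using gamma_dens0_integral[OF assms] gamma_dens0_nonneg[OF assms(1)]
    by (subst nn_integral_eq_integral) (auto simp: has_bochner_integral_iff)
  then have "prob_space (gamma_distr \<kappa> \<theta>)"
    by (intro prob_spaceI) (simp add: gamma_distr_def emeasure_density)
  then show ?thesis
    by (simp add: real_distribution_def real_distribution_axioms_def)
qed

lemma gamma_distr_AE_pos: "AE x in gamma_distr \<kappa> \<theta>. x > 0"
  unfolding gamma_distr_def by (subst AE_density) (auto simp: gamma_dens0_def indicator_def)

lemma distr_gamma_density:
  assumes "\<kappa> > 0"
  shows "distr (density (restrict_space lborel {0<..}) (\<lambda>x. ennreal (gamma_dens \<kappa> \<theta> x))) borel (\<lambda>x. x)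
    = gamma_distr \<kappa> \<theta>" (is "distr ?D _ _ = _")
proof (rule measure_eqI)
  fix A assume "A \<in> sets (distr ?D borel (\<lambda>x. x))"
  then have A[measurable]: "A \<in> sets borel" by simp
  have m[measurable]: "(\<lambda>x. x) \<in> measurable (restrict_space lborel {0<..}) borel"
    "gamma_dens \<kappa> \<theta> \<in> borel_measurable (restrict_space lborel {0<..})"
    by (auto intro!: measurable_restrict_space1)
  have A': "A \<inter> {0<..} \<in> sets (restrict_space lborel {0<..})"
    using A by (auto simp: sets_restrict_space)
  have "emeasure (distr ?D borel (\<lambda>x. x)) A = emeasure ?D (A \<inter> {0<..})"
    by (subst emeasure_distr) (auto simp: space_restrict_space)
  also have "\<dots> = (\<integral>\<^sup>+x. ennreal (gamma_dens \<kappa> \<theta> x) * indicator (A \<inter> {0<..}) x \<partial>restrict_space lborel {0<..})"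
    using A' by (subst emeasure_density) auto
  also have "\<dots> = (\<integral>\<^sup>+x. ennreal (gamma_dens \<kappa> \<theta> x) * indicator (A \<inter> {0<..}) x * indicator {0<..} x \<partial>lborel)"
    by (subst nn_integral_restrict_space) auto
  also have "\<dots> = emeasure (gamma_distr \<kappa> \<theta>) A"
    unfolding gamma_distr_def
    by (subst emeasure_density)
       (auto intro!: nn_integral_cong simp: gamma_dens0_def indicator_def)
  finally show "emeasure (distr ?D borel (\<lambda>x. x)) A = emeasure (gamma_distr \<kappa> \<theta>) A" .
qed simp

text \<open>The densities converge pointwise and all have integral 1, so Scheffe's lemma gives
  convergence in the mean. The probabilities of every Borel set then converge, in particular those
  of continuity sets.\<close>

lemma gamma_distr_weak_conv:
  assumes pos: "\<And>n. k n > 0" "\<And>n. t n > 0" "\<kappa> > 0" "\<theta> > 0"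
    and k: "k \<longlonglongrightarrow> \<kappa>" and t: "t \<longlonglongrightarrow> \<theta>"
  shows "weak_conv_m (\<lambda>n. gamma_distr (k n) (t n)) (gamma_distr \<kappa> \<theta>)"
proof (rule continuity_set_conv_imp_weak_conv)
  fix A :: "real set" assume A[measurable]: "A \<in> sets borel"
  have int: "integrable lborel (gamma_dens0 (k n) (t n))" "integrable lborel (gamma_dens0 \<kappa> \<theta>)" for n
    using gamma_dens0_integral pos by (auto simp: has_bochner_integral_iff)
  have meas: "measure (gamma_distr a b) A = (\<integral>x. gamma_dens0 a b x * indicator A x \<partial>lborel)"
    if "a > 0" for a b
    using integral_density[of "indicator A :: real \<Rightarrow> real" lborel "gamma_dens0 a b"]
      gamma_dens0_nonneg[OF that] by (simp add: gamma_distr_def)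
  have L1: "(\<lambda>n. \<integral>x. \<bar>gamma_dens0 (k n) (t n) x - gamma_dens0 \<kappa> \<theta> x\<bar> \<partial>lborel) \<longlonglongrightarrow> 0"
  proof (rule Scheffe_integral[OF int])
    have "(\<lambda>n. gamma_dens (k n) (t n) x) \<longlonglongrightarrow> gamma_dens \<kappa> \<theta> x" if "x > 0" for x
    proof -
      \<comment> \<open>Staying off the poles gives continuity of the Gamma function at
        \<open>\<kappa>\<close> and also that its value there is nonzero.\<close>
      have notin: "\<kappa> \<notin> \<int>\<^sub>\<le>\<^sub>0" using pos(3) by (auto elim!: nonpos_Ints_cases)
      then have "Gamma \<kappa> \<noteq> 0" by (simp add: Gamma_eq_zero_iff)
      then have nz: "\<theta> powr \<kappa> * Gamma \<kappa> \<noteq> 0" "x \<noteq> 0" "\<theta> \<noteq> 0"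
        using that pos(4) by simp_all
      show ?thesis
        unfolding gamma_dens_def using notin
        by (intro tendsto_divide[OF tendsto_mult[OF tendsto_powr[OF tendsto_const
              tendsto_diff[OF k tendsto_const] nz(2)]
            tendsto_exp[OF tendsto_divide[OF tendsto_const t nz(3)]]]
            tendsto_mult[OF tendsto_powr[OF t k nz(3)] tendsto_Gamma[OF k]] nz(1)])
    qed
    then show "AE x in lborel. (\<lambda>n. gamma_dens0 (k n) (t n) x) \<longlonglongrightarrow> gamma_dens0 \<kappa> \<theta> x"
      by (intro AE_I2) (auto simp: gamma_dens0_def indicator_def)
    have "(\<integral>x. gamma_dens0 (k n) (t n) x \<partial>lborel) = (\<integral>x. gamma_dens0 \<kappa> \<theta> x \<partial>lborel)" for n
      using gamma_dens0_integral pos by (simp add: has_bochner_integral_iff)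
    then show "(\<lambda>n. \<integral>x. gamma_dens0 (k n) (t n) x \<partial>lborel) \<longlonglongrightarrow> (\<integral>x. gamma_dens0 \<kappa> \<theta> x \<partial>lborel)"
      by simp
  qed (intro gamma_dens0_nonneg pos)+
  have "\<bar>measure (gamma_distr (k n) (t n)) A - measure (gamma_distr \<kappa> \<theta>) A\<bar>
    \<le> (\<integral>x. \<bar>gamma_dens0 (k n) (t n) x - gamma_dens0 \<kappa> \<theta> x\<bar> \<partial>lborel)" for n
  proof -
    have i: "integrable lborel (\<lambda>x. gamma_dens0 (k n) (t n) x * indicator A x)"
      "integrable lborel (\<lambda>x. gamma_dens0 \<kappa> \<theta> x * indicator A x)"
      using int(1)[of n] int(2) by (auto intro!: integrable_real_mult_indicator)
    have "\<bar>measure (gamma_distr (k n) (t n)) A - measure (gamma_distr \<kappa> \<theta>) A\<bar> =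
      \<bar>\<integral>x. (gamma_dens0 (k n) (t n) x * indicator A x - gamma_dens0 \<kappa> \<theta> x * indicator A x) \<partial>lborel\<bar>"
      using i pos by (simp add: meas)
    also have "\<dots> \<le> (\<integral>x. \<bar>gamma_dens0 (k n) (t n) x * indicator A x - gamma_dens0 \<kappa> \<theta> x * indicator A x\<bar> \<partial>lborel)"
      by (rule integral_abs_bound)
    also have "\<dots> \<le> (\<integral>x. \<bar>gamma_dens0 (k n) (t n) x - gamma_dens0 \<kappa> \<theta> x\<bar> \<partial>lborel)"
      by (intro integral_mono) (use i int(1)[of n] int(2) in \<open>auto simp: indicator_def\<close>)
    finally show ?thesis .
  qed
  then have "\<forall>\<^sub>F n in sequentially. norm (measure (gamma_distr (k n) (t n)) A - measure (gamma_distr \<kappa> \<theta>) A)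
    \<le> (\<integral>x. \<bar>gamma_dens0 (k n) (t n) x - gamma_dens0 \<kappa> \<theta> x\<bar> \<partial>lborel)"
    unfolding real_norm_def by (rule always_eventually[OF allI])
  from this L1 have "(\<lambda>n. measure (gamma_distr (k n) (t n)) A - measure (gamma_distr \<kappa> \<theta>) A) \<longlonglongrightarrow> 0"
    by (rule Lim_null_comparison)
  then show "(\<lambda>n. measure (gamma_distr (k n) (t n)) A) \<longlonglongrightarrow> measure (gamma_distr \<kappa> \<theta>) A"
    by (rule LIM_zero_cancel)
next
  show "real_distribution (gamma_distr (k n) (t n))" for n
    using pos(1,2) by (rule real_distribution_gamma)
  show "real_distribution (gamma_distr \<kappa> \<theta>)"
    using pos(3,4) by (rule real_distribution_gamma)
qed

text \<open>With \<open>q = \<theta> / (1 + \<theta>)\<close> the functional equation of the Gamma function gives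
  \<open>b 1 / b 0 = \<kappa> q\<close> and \<open>b 2 / b 1 = (\<kappa> + 1) q\<close>.\<close>

lemma gamma_distr_parameters:
  fixes \<kappa> \<theta> :: real
  defines "b \<equiv> \<lambda>j. \<integral>x. x ^ j * exp (- x) \<partial>gamma_distr \<kappa> \<theta>"
  defines "q \<equiv> b 2 / b 1 - b 1 / b 0"
  assumes "\<kappa> > 0" "\<theta> > 0"
  shows "b 0 > 0" "b 1 > 0" "q = \<theta> / (1 + \<theta>)" "\<kappa> = b 1 / b 0 / q" "\<theta> = q / (1 - q)"
proof -
  define r where "r = \<theta> / (1 + \<theta>)"
  have r: "r > 0" "r < 1" using assms(4) by (auto simp: r_def)
  have b: "b j = Gamma (\<kappa> + j) * r powr (\<kappa> + j) / (Gamma \<kappa> * \<theta> powr \<kappa>)" for j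
    using gamma_distr_moment[OF assms(3,4), of 1 j] by (simp add: b_def r_def has_bochner_integral_iff)
  have "\<kappa> \<notin> \<int>\<^sub>\<le>\<^sub>0" "\<kappa> + 1 \<notin> \<int>\<^sub>\<le>\<^sub>0" using assms(3) by (auto elim!: nonpos_Ints_cases)
  then have G: "Gamma (\<kappa> + 1) = \<kappa> * Gamma \<kappa>" "Gamma (\<kappa> + 2) = (\<kappa> + 1) * Gamma (\<kappa> + 1)"
    using Gamma_plus1[of \<kappa>] Gamma_plus1[of "\<kappa> + 1"] by (simp_all add: add.assoc)
  have P: "r powr (\<kappa> + 1) = r * r powr \<kappa>" "r powr (\<kappa> + 2) = r * r powr (\<kappa> + 1)"
    using r powr_add[of r "\<kappa> + 1" 1] by (simp_all add: powr_add add.assoc)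
  have b0: "b 0 > 0" unfolding b using assms(3,4) r less_imp_neq[OF Gamma_real_pos[OF assms(3)]] by simp
  have b1: "b 1 = \<kappa> * r * b 0" using G P by (simp add: b)
  have b2: "b 2 = (\<kappa> + 1) * r * b 1" using G P by (simp add: b)
  show "b 0 > 0" "b 1 > 0" using b0 b1 assms(3) r by auto
  \<comment> \<open>In the difference of the ratios \<open>(\<kappa> + 1) * r\<close> and
    \<open>\<kappa> * r\<close> the shape cancels.\<close>
  have q: "q = r"
    unfolding q_def b2 using b0 b1 assms(3) r by (simp add: field_simps)
  then show "q = \<theta> / (1 + \<theta>)" by (simp add: r_def)
  show "\<kappa> = b 1 / b 0 / q" unfolding q b1 using less_imp_neq[OF b0] r by simp
  show "\<theta> = q / (1 - q)" unfolding q r_def using assms(4) by (simp add: field_simps)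
qed

text \<open>Both parameters are rational expressions in the three integrals. At the limit the
  divisors \<open>\<beta> 0\<close>, \<open>\<beta> 1\<close>, \<open>p\<close> and
  \<open>1 - p\<close> are positive, so the expressions are continuous there.\<close>

lemma gamma_distr_parameters_tendsto:
  assumes pos: "\<And>n. k n > 0" "\<And>n. t n > 0" "\<kappa> > 0" "\<theta> > 0"
    and lim: "\<And>j. j \<le> 2 \<Longrightarrow> (\<lambda>n. \<integral>x. x ^ j * exp (- x) \<partial>gamma_distr (k n) (t n)) \<longlonglongrightarrow>
      (\<integral>x. x ^ j * exp (- x) \<partial>gamma_distr \<kappa> \<theta>)"
  shows "k \<longlonglongrightarrow> \<kappa>" "t \<longlonglongrightarrow> \<theta>"
proof -
  define b where "b n j = (\<integral>x. x ^ j * exp (- x) \<partial>gamma_distr (k n) (t n))" for n j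
  define \<beta> where "\<beta> j = (\<integral>x. x ^ j * exp (- x) \<partial>gamma_distr \<kappa> \<theta>)" for j :: nat
  define q where "q n = b n 2 / b n 1 - b n 1 / b n 0" for n
  define p where "p = \<beta> 2 / \<beta> 1 - \<beta> 1 / \<beta> 0"
  have param: "k n = b n 1 / b n 0 / q n" "t n = q n / (1 - q n)" for n
    using gamma_distr_parameters(4,5)[OF pos(1,2)[of n]] unfolding b_def q_def by auto
  note limit = gamma_distr_parameters[OF pos(3,4), folded \<beta>_def, folded p_def]
  have L: "(\<lambda>n. b n j) \<longlonglongrightarrow> \<beta> j" if "j \<le> 2" for j
    using lim[OF that] by (simp add: b_def \<beta>_def)
  have p: "p > 0" "p < 1" using limit(3) pos(3,4) by auto
  have "q \<longlonglongrightarrow> p"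
    unfolding q_def p_def using limit(1,2) by (intro tendsto_intros L) auto
  then have "(\<lambda>n. b n 1 / b n 0 / q n) \<longlonglongrightarrow> \<beta> 1 / \<beta> 0 / p" "(\<lambda>n. q n / (1 - q n)) \<longlonglongrightarrow> p / (1 - p)"
    using limit(1) p by (auto intro!: tendsto_intros L)
  then show "k \<longlonglongrightarrow> \<kappa>" "t \<longlonglongrightarrow> \<theta>"
    unfolding param[abs_def] limit(4)[symmetric] limit(5)[symmetric] by simp_all
qed

subsection \<open>Coupling and robustness\<close>

lemma gamma_class_obtain:
  assumes "\<mu> \<in> gamma_class"
  obtains \<kappa> \<theta> where "\<kappa> > 0" "\<theta> > 0" "distr \<mu> borel (\<lambda>x. x) = gamma_distr \<kappa> \<theta>"
    "sets \<mu> = sets pos_borel"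
  using assms distr_gamma_density unfolding gamma_class_def borel_probs_def by blast

text \<open>Stated for sequences because Skorohod's theorem represents a whole weakly convergent
  sequence together with its limit on one space. The means \<open>\<kappa> * \<theta>\<close>
  converge along with the parameters, and this upgrades almost sure convergence to convergence in
  the mean.\<close>

lemma gamma_class_coupling:
  assumes \<mu>: "\<mu> \<in> gamma_class" and \<nu>: "\<And>n. \<nu> n \<in> gamma_class"
    and lim: "\<And>j. j \<le> 2 \<Longrightarrow>
      (\<lambda>n. \<integral>x. x ^ j * exp (- x) \<partial>\<nu> n) \<longlonglongrightarrow> (\<integral>x. x ^ j * exp (- x) \<partial>\<mu>)"
  obtains \<Omega> :: "real measure" and X Y where "prob_space \<Omega>"
    "X \<in> measurable \<Omega> pos_borel" "\<And>n. Y n \<in> measurable \<Omega> pos_borel"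
    "distr \<Omega> pos_borel X = \<mu>" "\<And>n. distr \<Omega> pos_borel (Y n) = \<nu> n"
    "integrable \<Omega> X" "\<And>n. integrable \<Omega> (Y n)"
    "(\<lambda>n. \<integral>\<omega>. \<bar>X \<omega> - Y n \<omega>\<bar> \<partial>\<Omega>) \<longlonglongrightarrow> 0"
proof -
  obtain \<kappa> \<theta> where \<kappa>: "\<kappa> > 0" "\<theta> > 0" and D: "distr \<mu> borel (\<lambda>x. x) = gamma_distr \<kappa> \<theta>"
    and sets: "sets \<mu> = sets pos_borel"
    using gamma_class_obtain[OF \<mu>] by blast
  have "\<exists>k t. k > 0 \<and> t > 0 \<and> distr (\<nu> n) borel (\<lambda>x. x) = gamma_distr k t \<and> sets (\<nu> n) = sets pos_borel" for n
    using gamma_class_obtain[OF \<nu>[of n]] by blast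
  then obtain k t where k: "\<And>n. k n > 0" "\<And>n. t n > 0"
    and E: "\<And>n. distr (\<nu> n) borel (\<lambda>x. x) = gamma_distr (k n) (t n)"
    and setsn: "\<And>n. sets (\<nu> n) = sets pos_borel"
    by metis
  have id_meas: "(\<lambda>x. x) \<in> measurable M borel" if "sets M = sets pos_borel" for M
    unfolding measurable_cong_sets[OF that refl] by (intro measurable_restrict_space1) simp
  have int: "(\<integral>x. f x \<partial>M) = (\<integral>x. f x \<partial>distr M borel (\<lambda>x. x))"
    if "sets M = sets pos_borel" "f \<in> borel_measurable borel" for M and f :: "real \<Rightarrow> real"
    using id_meas[OF that(1)] that(2) by (simp add: integral_distr)
  have "(\<lambda>n. \<integral>x. x ^ j * exp (- x) \<partial>gamma_distr (k n) (t n)) \<longlonglongrightarrow>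
      (\<integral>x. x ^ j * exp (- x) \<partial>gamma_distr \<kappa> \<theta>)" if "j \<le> 2" for j
    using lim[OF that] by (simp add: int sets setsn D E)
  from gamma_distr_parameters_tendsto[OF k \<kappa> this]
  have k_lim: "k \<longlonglongrightarrow> \<kappa>" and t_lim: "t \<longlonglongrightarrow> \<theta>" by auto
  obtain \<Omega> :: "real measure" and Y0 X0 where \<Omega>: "prob_space \<Omega>"
    and Y0[measurable]: "\<And>n. Y0 n \<in> measurable \<Omega> borel"
    and dY0: "\<And>n. distr \<Omega> borel (Y0 n) = gamma_distr (k n) (t n)"
    and X0': "X0 \<in> measurable \<Omega> lborel" and dX0: "distr \<Omega> borel X0 = gamma_distr \<kappa> \<theta>"
    and conv: "\<And>\<omega>. \<omega> \<in> space \<Omega> \<Longrightarrow> (\<lambda>n. Y0 n \<omega>) \<longlonglongrightarrow> X0 \<omega>"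
    using Skorohod[OF real_distribution_gamma real_distribution_gamma
        gamma_distr_weak_conv[OF k \<kappa> k_lim t_lim], OF k \<kappa>] by blast
  from X0' have X0[measurable]: "X0 \<in> measurable \<Omega> borel" by simp
  \<comment> \<open>Skorohod's variables are positive only almost surely.\<close>
  define pos :: "real \<Rightarrow> real" where "pos x = (if x > 0 then x else 1)" for x
  have [measurable]: "pos \<in> borel_measurable borel" unfolding pos_def[abs_def] by measurable
  have pos_gt: "pos x > 0" for x by (simp add: pos_def)
  have pos_meas: "pos \<in> measurable borel pos_borel"
    by (intro measurable_restrict_space2) (auto simp: pos_gt)
  \<comment> \<open>Since \<open>pos\<close> fixes every positive number, it acts as the identity
    under \<open>M\<close>; it brings a real variable with that law back to the half-line.\<close>
  have distr_pos: "distr \<Omega> pos_borel (\<lambda>\<omega>. pos (Z \<omega>)) = M"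
    if "distr \<Omega> borel Z = distr M borel (\<lambda>x. x)" "sets M = sets pos_borel" "Z \<in> measurable \<Omega> borel"
    for Z M
  proof -
    have "distr \<Omega> pos_borel (\<lambda>\<omega>. pos (Z \<omega>)) = distr (distr M borel (\<lambda>x. x)) pos_borel pos"
      using distr_distr[OF pos_meas that(3)] that(1) by (simp add: comp_def)
    also have "\<dots> = distr M pos_borel pos"
      using distr_distr[OF pos_meas id_meas[OF that(2)]] by (simp add: comp_def)
    also have "\<dots> = distr M M (\<lambda>x. x)"
      using sets_eq_imp_space_eq[OF that(2)] that(2)
      by (intro distr_cong) (auto simp: pos_def space_restrict_space)
    also have "\<dots> = M" by (rule distr_id)
    finally show ?thesis .
  qed
  \<comment> \<open>The modification by \<open>pos\<close> affects only a null event, so the Gamma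
    mean is preserved.\<close>
  have moment: "integrable \<Omega> (\<lambda>\<omega>. pos (Z \<omega>)) \<and> (\<integral>\<omega>. pos (Z \<omega>) \<partial>\<Omega>) = a * b"
    if Z[measurable]: "Z \<in> measurable \<Omega> borel" and d: "distr \<Omega> borel Z = gamma_distr a b"
      and a: "a > 0" "b > 0" for Z a b
  proof -
    have "AE \<omega> in \<Omega>. Z \<omega> > 0"
      using gamma_distr_AE_pos[of a b] unfolding d[symmetric] by (subst (asm) AE_distr_iff) auto
    then have eq: "AE \<omega> in \<Omega>. Z \<omega> = pos (Z \<omega>)"
      by eventually_elim (simp add: pos_def)
    have mean: "integrable (distr \<Omega> borel Z) (\<lambda>x. x)" "(\<integral>x. x \<partial>distr \<Omega> borel Z) = a * b"
      using gamma_distr_mean[OF a] unfolding d has_bochner_integral_iff by blast+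
    have [measurable]: "(\<lambda>\<omega>. pos (Z \<omega>)) \<in> borel_measurable \<Omega>" by measurable
    have "integrable \<Omega> Z" using integrable_distr[OF Z mean(1)] .
    then have "integrable \<Omega> (\<lambda>\<omega>. pos (Z \<omega>))"
      by (rule integrable_cong_AE_imp) (use eq in \<open>auto simp: eq_commute\<close>)
    moreover have "(\<integral>\<omega>. pos (Z \<omega>) \<partial>\<Omega>) = (\<integral>\<omega>. Z \<omega> \<partial>\<Omega>)"
      by (rule integral_cong_AE) (use eq in \<open>auto simp: eq_commute\<close>)
    moreover have "(\<integral>\<omega>. Z \<omega> \<partial>\<Omega>) = a * b"
      using integral_distr[OF Z, of "\<lambda>x. x"] mean(2) by simp
    ultimately show ?thesis by simp
  qed
  show thesis
  proof (rule that[OF \<Omega>])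
    show "(\<lambda>\<omega>. pos (X0 \<omega>)) \<in> measurable \<Omega> pos_borel" "(\<lambda>\<omega>. pos (Y0 n \<omega>)) \<in> measurable \<Omega> pos_borel" for n
      using measurable_compose[OF X0 pos_meas] measurable_compose[OF Y0 pos_meas] by auto
    show "distr \<Omega> pos_borel (\<lambda>\<omega>. pos (X0 \<omega>)) = \<mu>"
      by (rule distr_pos) (simp_all add: D dX0 sets)
    show "distr \<Omega> pos_borel (\<lambda>\<omega>. pos (Y0 n \<omega>)) = \<nu> n" for n
      by (rule distr_pos) (simp_all add: E dY0 setsn)
    note mX = moment[OF X0 dX0 \<kappa>, THEN conjunct1] moment[OF X0 dX0 \<kappa>, THEN conjunct2]
    note mY = moment[OF Y0 dY0 k, THEN conjunct1] moment[OF Y0 dY0 k, THEN conjunct2]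
    show "integrable \<Omega> (\<lambda>\<omega>. pos (X0 \<omega>))" "integrable \<Omega> (\<lambda>\<omega>. pos (Y0 n \<omega>))" for n
      by (rule mX(1), rule mY(1))
    have "AE \<omega> in \<Omega>. X0 \<omega> > 0"
      using gamma_distr_AE_pos[of \<kappa> \<theta>] unfolding dX0[symmetric] by (subst (asm) AE_distr_iff) auto
    then have "AE \<omega> in \<Omega>. (\<lambda>n. pos (Y0 n \<omega>)) \<longlonglongrightarrow> pos (X0 \<omega>)"
    proof (rule AE_mp, intro AE_I2 impI)
      fix \<omega> assume \<omega>: "\<omega> \<in> space \<Omega>" "X0 \<omega> > 0"
      \<comment> \<open>Although \<open>pos\<close> jumps at 0, a sequence with a positive limit is
        eventually positive and then left unchanged.\<close>
      from order_tendstoD(1)[OF conv[OF \<omega>(1)] \<omega>(2)]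
      have "eventually (\<lambda>n. pos (Y0 n \<omega>) = Y0 n \<omega>) sequentially"
        by eventually_elim (simp add: pos_def)
      then show "(\<lambda>n. pos (Y0 n \<omega>)) \<longlonglongrightarrow> pos (X0 \<omega>)"
        using conv[OF \<omega>(1)] \<omega>(2) by (simp add: pos_def[of "X0 \<omega>"] tendsto_cong)
    qed
    moreover have "(\<lambda>n. \<integral>\<omega>. pos (Y0 n \<omega>) \<partial>\<Omega>) \<longlonglongrightarrow> (\<integral>\<omega>. pos (X0 \<omega>) \<partial>\<Omega>)"
      unfolding mX(2) mY(2) using k_lim t_lim by (rule tendsto_mult)
    ultimately have "(\<lambda>n. \<integral>\<omega>. \<bar>pos (Y0 n \<omega>) - pos (X0 \<omega>)\<bar> \<partial>\<Omega>) \<longlonglongrightarrow> 0"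
      by (rule Scheffe_integral[OF mY(1) mX(1) less_imp_le[OF pos_gt] less_imp_le[OF pos_gt]])
    then show "(\<lambda>n. \<integral>\<omega>. \<bar>pos (X0 \<omega>) - pos (Y0 n \<omega>)\<bar> \<partial>\<Omega>) \<longlonglongrightarrow> 0"
      by (simp add: abs_minus_commute)
  qed
qed

text \<open>A metric with the usual topology need not be uniformly comparable with the Euclidean one
  on the half-line, but it is near a compact interval. Otherwise there are pairs with vanishing
  Euclidean distance; along a subsequence both points tend to one limit, and a small
  \<open>d\<close>-ball around it contains both.\<close>

lemma metric_modulus_on_compact:
  fixes d :: "real \<Rightarrow> real \<Rightarrow> real"
  assumes "Metric_space {0<..} d" and top: "Metric_space.mtopology {0<..} d = top_of_set {0<..}"
    and a: "0 < a" and \<epsilon>: "\<epsilon> > 0"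
  obtains \<delta> where "\<delta> > 0"
    "\<And>x y. x \<in> {a..b} \<Longrightarrow> y > 0 \<Longrightarrow> \<bar>x - y\<bar> < \<delta> \<Longrightarrow> d x y < \<epsilon>"
proof (rule ccontr)
  interpret Metric_space "{0<..}" d by fact
  assume "\<not> thesis"
  then have "\<exists>x y. x \<in> {a..b} \<and> y > 0 \<and> \<bar>x - y\<bar> < 1 / Suc n \<and> \<not> d x y < \<epsilon>" for n
    using that[of "1 / Suc n"] by auto
  then obtain x y where x: "\<And>n. x n \<in> {a..b}" and y: "\<And>n. y n > 0"
    and xy: "\<And>n. \<bar>x n - y n\<bar> < 1 / Suc n" and far: "\<And>n. \<not> d (x n) (y n) < \<epsilon>"
    by metis
  obtain l r where l: "l \<in> {a..b}" and r: "strict_mono r" and xl: "(x \<circ> r) \<longlonglongrightarrow> l"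
    using compact_Icc[of a b] x unfolding compact_def by metis
  have "(\<lambda>n. x n - y n) \<longlonglongrightarrow> 0"
    using xy by (intro Lim_null_comparison[OF _ LIMSEQ_inverse_real_of_nat])
      (auto intro!: always_eventually less_imp_le simp: inverse_eq_divide)
  then have "((\<lambda>n. x n - y n) \<circ> r) \<longlonglongrightarrow> 0"
    using r by (rule LIMSEQ_subseq_LIMSEQ)
  from tendsto_diff[OF xl this] have yl: "(y \<circ> r) \<longlonglongrightarrow> l"
    by (simp add: comp_def)
  \<comment> \<open>The bound \<open>a > 0\<close> keeps the limit point inside the space on which
    \<open>d\<close> is a metric.\<close>
  have l0: "l > 0" using l a by simp
  have "openin (top_of_set {0<..}) (mball l (\<epsilon> / 2))"
    using openin_mball top by metis
  then have "open (mball l (\<epsilon> / 2))"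
    by (simp add: openin_open_eq[OF open_greaterThan])
  moreover have "l \<in> mball l (\<epsilon> / 2)" using l0 \<epsilon> by simp
  ultimately have "eventually (\<lambda>n. (x \<circ> r) n \<in> mball l (\<epsilon> / 2)) sequentially"
    "eventually (\<lambda>n. (y \<circ> r) n \<in> mball l (\<epsilon> / 2)) sequentially"
    by (rule topological_tendstoD[OF xl], rule topological_tendstoD[OF yl])
  then have "eventually (\<lambda>n. False) sequentially"
  proof eventually_elim
    case (elim n)
    then have "d l (x (r n)) < \<epsilon> / 2" "d l (y (r n)) < \<epsilon> / 2" "x (r n) > 0"
      by auto
    moreover have "d (x (r n)) (y (r n)) \<le> d l (x (r n)) + d l (y (r n))"
      using triangle[of "x (r n)" l "y (r n)"] commute[of l "x (r n)"] l0 y[of "r n"] calculation by auto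
    ultimately show False using far[of "r n"] by auto
  qed
  then show False by simp
qed

text \<open>If two coupled variables are \<open>d\<close>-closer than \<open>\<epsilon>\<close>
  outside an event of probability at most \<open>\<epsilon>\<close>, the Prohorov distance of their
  laws is at most \<open>\<epsilon>\<close>. The number \<open>\<delta>\<close> is fixed before
  \<open>Y\<close> and \<open>n\<close>, since tightness and the modulus involve only
  \<open>X\<close>.\<close>

lemma prohorov_sample_mean_le:
  fixes d :: "real \<Rightarrow> real \<Rightarrow> real"
  assumes d: "Metric_space {0<..} d" and top: "Metric_space.mtopology {0<..} d = top_of_set {0<..}"
    and \<Omega>: "prob_space \<Omega>" and X: "X \<in> measurable \<Omega> pos_borel" "integrable \<Omega> X"
    and \<epsilon>: "\<epsilon> > 0"
  obtains \<delta> where "\<delta> > 0"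
    "\<And>Y n. Y \<in> measurable \<Omega> pos_borel \<Longrightarrow> integrable \<Omega> Y \<Longrightarrow> (\<integral>\<omega>. \<bar>X \<omega> - Y \<omega>\<bar> \<partial>\<Omega>) < \<delta> \<Longrightarrow> n \<ge> 1 \<Longrightarrow>
      prohorov {0<..} d
        (distr (PiM UNIV (\<lambda>_::nat. distr \<Omega> pos_borel X)) pos_borel (sample_mean n))
        (distr (PiM UNIV (\<lambda>_::nat. distr \<Omega> pos_borel Y)) pos_borel (sample_mean n)) \<le> \<epsilon>"
proof -
  interpret Metric_space "{0<..}" d by fact
  interpret \<Omega>: prob_space \<Omega> by fact
  let ?P = "PiM UNIV (\<lambda>_::nat. \<Omega>)"
  interpret P: prob_space ?P by (intro prob_space_PiM) (rule \<Omega>)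
  have pos: "Z \<omega> > 0" if "Z \<in> measurable \<Omega> pos_borel" "\<omega> \<in> space \<Omega>" for Z \<omega>
    using measurable_space[OF that] by (simp add: space_restrict_space)
  obtain a b where a: "0 < a" and tight: "\<And>n. n \<ge> 1 \<Longrightarrow>
      P.prob {\<omega> \<in> space ?P. sample_mean n (\<lambda>i. X (\<omega> i)) \<notin> {a..b}} \<le> \<epsilon> / 2"
    using sample_mean_tight[OF \<Omega> X(2) pos[OF X(1)], of "\<epsilon> / 2"] \<epsilon> by auto
  obtain \<eta> where \<eta>: "\<eta> > 0"
    and mod: "\<And>x y. x \<in> {a..b} \<Longrightarrow> y > 0 \<Longrightarrow> \<bar>x - y\<bar> < \<eta> \<Longrightarrow> d x y < \<epsilon>"
    using metric_modulus_on_compact[OF d top a \<epsilon>] by blast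
  show thesis
  proof (rule that)
    \<comment> \<open>With this bound on the expected distance, Markov's inequality at level
      \<open>\<eta>\<close> costs \<open>\<epsilon> / 2\<close>; the other half is spent on leaving
      the compact interval.\<close>
    show "\<eta> * \<epsilon> / 2 > 0" using \<eta> \<epsilon> by simp
    fix Y and n :: nat
    assume Y: "Y \<in> measurable \<Omega> pos_borel" "integrable \<Omega> Y"
      and small: "(\<integral>\<omega>. \<bar>X \<omega> - Y \<omega>\<bar> \<partial>\<Omega>) < \<eta> * \<epsilon> / 2" and n: "n \<ge> 1"
    have mean_meas: "sample_mean n \<in> measurable (PiM UNIV (\<lambda>_. pos_borel)) pos_borel"
    proof (rule measurable_restrict_space2)
      show "sample_mean n \<in> space (PiM UNIV (\<lambda>_. pos_borel)) \<rightarrow> {0<..}"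
        using sample_mean_pos[OF n] by (auto simp: space_PiM PiE_iff space_restrict_space)
      have "(\<lambda>x. x) \<in> measurable pos_borel borel" by (intro measurable_restrict_space1) simp
      then have [measurable]: "(\<lambda>x. x i) \<in> borel_measurable (PiM UNIV (\<lambda>_::nat. pos_borel))" for i
        by (rule measurable_compose[of _ _ pos_borel, rotated]) (rule measurable_component_singleton, simp)
      show "sample_mean n \<in> measurable (PiM UNIV (\<lambda>_. pos_borel)) borel"
        unfolding sample_mean_def[abs_def] by measurable
    qed
    have comp: "(\<lambda>\<omega> i. Z (\<omega> i)) \<in> measurable ?P (PiM UNIV (\<lambda>_. pos_borel))"
      if "Z \<in> measurable \<Omega> pos_borel" for Z
      using that by (intro measurable_PiM_single')
        (auto simp: space_PiM PiE_iff space_restrict_space intro: pos)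
    let ?m = "\<lambda>Z \<omega>. sample_mean n (\<lambda>i. Z (\<omega> i))"
    let ?D = "\<lambda>Z. distr (PiM UNIV (\<lambda>_::nat. distr \<Omega> pos_borel Z)) pos_borel (sample_mean n)"
    have m_meas: "?m Z \<in> measurable ?P pos_borel" if "Z \<in> measurable \<Omega> pos_borel" for Z
      using measurable_compose[OF comp[OF that] mean_meas] .
    \<comment> \<open>Both laws of the mean are realised on the same product space, so the variables
      can be compared pointwise.\<close>
    have law: "?D Z = distr ?P pos_borel (?m Z)" if Z: "Z \<in> measurable \<Omega> pos_borel" for Z
      unfolding distr_PiM_componentwise[OF \<Omega> Z, symmetric]
      using distr_distr[OF mean_meas comp[OF Z]] by (simp add: comp_def)
    have m_pos: "?m Z \<omega> > 0" if "Z \<in> measurable \<Omega> pos_borel" "\<omega> \<in> space ?P" for Z \<omega>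
      using measurable_space[OF m_meas[OF that(1)] that(2)] by (simp add: space_restrict_space)
    define B1 where "B1 = {\<omega> \<in> space ?P. ?m X \<omega> \<notin> {a..b}}"
    define B2 where "B2 = {\<omega> \<in> space ?P. sample_mean n (\<lambda>i. \<bar>X (\<omega> i) - Y (\<omega> i)\<bar>) \<ge> \<eta>}"
    note [measurable] = borel_measurable_integrable[OF X(2)] borel_measurable_integrable[OF Y(2)]
    have [measurable]: "B1 \<in> P.events" "B2 \<in> P.events"
      unfolding B1_def B2_def sample_mean_def by measurable
    have "P.prob B2 \<le> (\<integral>\<omega>. \<bar>X \<omega> - Y \<omega>\<bar> \<partial>\<Omega>) / \<eta>"
      unfolding B2_def by (rule sample_mean_Markov[OF \<Omega>]) (use X Y \<eta> n in auto)
    also have "\<dots> \<le> \<epsilon> / 2" using small \<eta> by (simp add: field_simps)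
    finally have "P.prob (B1 \<union> B2) \<le> \<epsilon>"
      using tight[OF n, folded B1_def]
        measure_Un_le[OF \<open>B1 \<in> P.events\<close> \<open>B2 \<in> P.events\<close>] by simp
    note bad = this
    have close: "d (?m X \<omega>) (?m Y \<omega>) < \<epsilon>" if \<omega>: "\<omega> \<in> space ?P" "\<omega> \<notin> B1 \<union> B2" for \<omega>
    proof (rule mod)
      show "?m X \<omega> \<in> {a..b}" using \<omega> by (auto simp: B1_def)
      show "?m Y \<omega> > 0" using m_pos[OF Y(1) \<omega>(1)] .
      have "\<bar>?m X \<omega> - ?m Y \<omega>\<bar> = \<bar>\<Sum>i<n. X (\<omega> i) - Y (\<omega> i)\<bar> / n"
        by (simp add: sample_mean_def sum_subtractf diff_divide_distrib[symmetric])
      also have "\<dots> \<le> sample_mean n (\<lambda>i. \<bar>X (\<omega> i) - Y (\<omega> i)\<bar>)"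
        unfolding sample_mean_def by (intro divide_right_mono sum_abs) auto
      also have "\<dots> < \<eta>" using \<omega> by (auto simp: B2_def)
      finally show "\<bar>?m X \<omega> - ?m Y \<omega>\<bar> < \<eta>" .
    qed
    \<comment> \<open>Kept symmetric in form, as the Prohorov distance asks for both inequalities.
      On the good event, a mean of \<open>Z\<close> in \<open>A\<close> forces the mean of
      \<open>W\<close> into the neighbourhood of \<open>A\<close>.\<close>
    have one_sided: "measure (?D Z) A \<le> measure (?D W) {s \<in> {0<..}. \<exists>a\<in>A. d a s < \<epsilon>} + \<epsilon>"
      if Z: "Z \<in> measurable \<Omega> pos_borel" and W: "W \<in> measurable \<Omega> pos_borel"
        and A: "A \<in> sets pos_borel"
        and cl: "\<And>\<omega>. \<omega> \<in> space ?P \<Longrightarrow> \<omega> \<notin> B1 \<union> B2 \<Longrightarrow> d (?m Z \<omega>) (?m W \<omega>) < \<epsilon>" for Z W A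
    proof -
      let ?N = "{s \<in> {0<..}. \<exists>a\<in>A. d a s < \<epsilon>}"
      have A0: "A \<subseteq> {0<..}"
        using sets.sets_into_space[OF A] by (simp add: space_restrict_space)
      \<comment> \<open>As a union of open balls the neighbourhood is open, hence Borel.\<close>
      have "?N = (\<Union>a\<in>A. mball a \<epsilon>)" using A0 unfolding mball_def by blast
      then have "openin (top_of_set {0<..}) ?N"
        using openin_mball by (auto simp flip: top intro!: openin_Union)
      then have "open ?N" by (simp add: openin_open_eq[OF open_greaterThan])
      then have N: "?N \<in> sets pos_borel"
        by (auto simp: sets_restrict_space_iff)
      have "measure (?D Z) A = P.prob (?m Z -` A \<inter> space ?P)"
        unfolding law[OF Z] using A by (intro measure_distr m_meas Z) auto
      also have "\<dots> \<le> P.prob ((?m W -` ?N \<inter> space ?P) \<union> (B1 \<union> B2))"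
      proof (rule P.finite_measure_mono)
        show "?m W -` ?N \<inter> space ?P \<union> (B1 \<union> B2) \<in> P.events"
          using measurable_sets[OF m_meas[OF W] N] by auto
        show "?m Z -` A \<inter> space ?P \<subseteq> ?m W -` ?N \<inter> space ?P \<union> (B1 \<union> B2)"
          using cl m_pos[OF W] by auto
      qed
      also have "\<dots> \<le> P.prob (?m W -` ?N \<inter> space ?P) + P.prob (B1 \<union> B2)"
        using measurable_sets[OF m_meas[OF W] N] by (intro measure_Un_le) auto
      also have "P.prob (?m W -` ?N \<inter> space ?P) = measure (?D W) ?N"
        unfolding law[OF W] using N by (intro measure_distr[symmetric] m_meas W) auto
      finally show ?thesis using bad by simp
    qed
    show "prohorov {0<..} d (?D X) (?D Y) \<le> \<epsilon>"
      unfolding prohorov_def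
    \<comment> \<open>It suffices that \<open>\<epsilon>\<close> itself is admissible in the
      infimum, all admissible numbers being positive.\<close>
    proof (rule cInf_lower)
      have "d (?m Y \<omega>) (?m X \<omega>) < \<epsilon>" if "\<omega> \<in> space ?P" "\<omega> \<notin> B1 \<union> B2" for \<omega>
        using close[OF that] by (simp add: commute)
      then show "\<epsilon> \<in> {\<epsilon>. \<epsilon> > 0 \<and> (\<forall>A \<in> sets pos_borel.
          measure (?D X) A \<le> measure (?D Y) {s \<in> {0<..}. \<exists>a\<in>A. d a s < \<epsilon>} + \<epsilon> \<and>
          measure (?D Y) A \<le> measure (?D X) {s \<in> {0<..}. \<exists>a\<in>A. d a s < \<epsilon>} + \<epsilon>)}"
        using \<epsilon> one_sided[OF X(1) Y(1) _ close] one_sided[OF Y(1) X(1)] by auto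
    qed (auto intro!: bdd_belowI[of _ 0])
  qed
qed

section \<open>Weak neighbourhoods from test integrals, and robustness\<close>

lemma openin_weak_test_ball:
  fixes f :: "'a::topological_space \<Rightarrow> real"
  assumes "M \<subseteq> borel_probs E" "continuous_on E f" "bounded (f ` E)"
  shows "openin (subtopology (weak_topology E) M) {\<nu> \<in> M. \<bar>(\<integral>x. f x \<partial>\<nu>) - c\<bar> < r}"
proof -
  let ?O = "{\<nu> \<in> borel_probs E. (\<integral>x. f x \<partial>\<nu>) \<in> {c - r<..<c + r}}"
  have "?O \<in> {{\<mu> \<in> borel_probs E. (\<integral>x. f x \<partial>\<mu>) \<in> V} | (f :: 'a \<Rightarrow> real) V.
      continuous_on E f \<and> bounded (f ` E) \<and> open V}"
    using assms(2,3) open_greaterThanLessThan[of "c - r" "c + r"] by blast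
  then have "openin (weak_topology E) ?O"
    unfolding weak_topology_def by (rule topology_generated_by_Basis)
  moreover have "{\<nu> \<in> M. \<bar>(\<integral>x. f x \<partial>\<nu>) - c\<bar> < r} = ?O \<inter> M"
    using assms(1) by (auto simp: abs_less_iff)
  ultimately show ?thesis unfolding openin_subtopology by blast
qed

text \<open>The lower bound \<open>1 + x + x\<^sup>2 / 2\<close> for the exponential dominates each
  of the three powers up to the factor 2. The exponential weight is what admits these functions as
  tests for the weak topology.\<close>

lemma bounded_power_times_exp_minus:
  assumes "j \<le> 2"
  shows "bounded ((\<lambda>x::real. x ^ j * exp (- x)) ` {0<..})"
proof (rule boundedI)
  fix y assume "y \<in> (\<lambda>x::real. x ^ j * exp (- x)) ` {0<..}"
  then obtain x where x: "x > 0" and y: "y = x ^ j * exp (- x)" by auto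
  have "x ^ j \<le> 2 * exp x"
  proof -
    have "1 + x + x\<^sup>2 / 2 \<le> exp x"
      using exp_lower_Taylor_quadratic[of x] x by simp
    then have "1 \<le> 2 * exp x" "x \<le> 2 * exp x" "x\<^sup>2 \<le> 2 * exp x"
      using x zero_le_power2[of x] by linarith+
    moreover have "j = 0 \<or> j = 1 \<or> j = 2" using assms by auto
    ultimately show ?thesis by auto
  qed
  then show "norm y \<le> 2" using x by (simp add: y exp_minus divide_inverse[symmetric] pos_divide_le_eq)
qed

theorem corollary4p7:
  fixes T :: "real measure \<Rightarrow> real" and d :: "real \<Rightarrow> real \<Rightarrow> real"
  assumes "Metric_space {0<..} d"
    and "Metric_space.mcomplete {0<..} d"
    and "Metric_space.mtopology {0<..} d = top_of_set {0<..}"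
    and "maximum_likelihood_functional (M1 {0<..} (\<lambda>x. x)) {0<..} exp_dens T"
  shows "robust_on {0<..} {0<..} d gamma_class (\<lambda>n x. T (empirical_measure {0<..} n x))"
proof -
  let ?law = "\<lambda>\<mu> n. distr (PiM (UNIV :: nat set) (\<lambda>_. \<mu>)) pos_borel (\<lambda>x. T (empirical_measure {0<..} n x))"
  \<comment> \<open>Sequences in the product space have positive entries, so the estimator may be
    replaced by the sample mean there.\<close>
  have law: "?law \<mu> n = distr (PiM UNIV (\<lambda>_. \<mu>)) pos_borel (sample_mean n)"
    if "\<mu> \<in> gamma_class" "n \<ge> 1" for \<mu> n
  proof (rule distr_cong)
    have "space \<mu> = {0<..}"
      using that(1) sets_eq_imp_space_eq[of \<mu> pos_borel]
      by (auto simp: gamma_class_def borel_probs_def space_restrict_space)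
    then show "T (empirical_measure {0<..} n x) = sample_mean n x"
      if "x \<in> space (PiM UNIV (\<lambda>_. \<mu>))" for x
      using that \<open>n \<ge> 1\<close> by (intro mle_exp_empirical[OF assms(4)]) (auto simp: space_PiM PiE_iff)
  qed auto
  show ?thesis
    unfolding robust_on_def
  proof (intro ballI allI impI, rule ccontr)
    fix \<mu> and \<epsilon> :: real
    assume \<mu>: "\<mu> \<in> gamma_class" and \<epsilon>: "\<epsilon> > 0"
      and no: "\<nexists>U. openin (subtopology (weak_topology {0<..}) gamma_class) U \<and> \<mu> \<in> U \<and>
        (\<forall>\<nu>\<in>U. \<forall>n\<ge>1. prohorov {0<..} d (?law \<mu> n) (?law \<nu> n) \<le> \<epsilon>)"
    define I where "I j \<nu> = (\<integral>x. x ^ j * exp (- x) \<partial>\<nu>)" for j and \<nu> :: "real measure"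
    \<comment> \<open>Shrinking weak neighbourhoods of \<open>\<mu>\<close>, cut out by the three
      test integrals that determine the parameters.\<close>
    define U where "U m = (\<Inter>j\<in>{..2}. {\<nu> \<in> gamma_class. \<bar>I j \<nu> - I j \<mu>\<bar> < 1 / Suc m})" for m :: nat
    have "openin (subtopology (weak_topology {0<..}) gamma_class) (U m)" for m
      unfolding U_def I_def
      by (intro openin_INT2 openin_weak_test_ball bounded_power_times_exp_minus continuous_intros)
         (auto simp: gamma_class_def)
    moreover have "\<mu> \<in> U m" for m using \<mu> by (simp add: U_def)
    \<comment> \<open>None of these neighbourhoods works, so each contains a law that fails at some
      sample size. The sample sizes may vary freely with \<open>m\<close>.\<close>
    ultimately have "\<exists>\<nu> n. \<nu> \<in> U m \<and> n \<ge> 1 \<and> \<not> prohorov {0<..} d (?law \<mu> n) (?law \<nu> n) \<le> \<epsilon>" for m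
      using no by meson
    then obtain \<nu> n where \<nu>: "\<And>m. \<nu> m \<in> U m" and n: "\<And>m. n m \<ge> 1"
      and far: "\<And>m. \<not> prohorov {0<..} d (?law \<mu> (n m)) (?law (\<nu> m) (n m)) \<le> \<epsilon>"
      by metis
    have \<nu>_class: "\<nu> m \<in> gamma_class" for m using \<nu>[of m] by (auto simp: U_def)
    have "(\<lambda>m. I j (\<nu> m)) \<longlonglongrightarrow> I j \<mu>" if "j \<le> 2" for j
    proof (rule LIM_zero_cancel, rule Lim_null_comparison[OF _ LIMSEQ_inverse_real_of_nat])
      have "\<bar>I j (\<nu> m) - I j \<mu>\<bar> < 1 / Suc m" for m
        using \<nu>[of m] that unfolding U_def by blast
      then show "\<forall>\<^sub>F m in sequentially. norm (I j (\<nu> m) - I j \<mu>) \<le> inverse (real (Suc m))"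
        unfolding real_norm_def inverse_eq_divide by (intro always_eventually allI less_imp_le)
    qed
    note I_lim = this
    obtain \<Omega> :: "real measure" and X Y where \<Omega>: "prob_space \<Omega>"
      and X: "X \<in> measurable \<Omega> pos_borel" and Y: "\<And>m. Y m \<in> measurable \<Omega> pos_borel"
      and X_distr: "distr \<Omega> pos_borel X = \<mu>" and Y_distr: "\<And>m. distr \<Omega> pos_borel (Y m) = \<nu> m"
      and X_int: "integrable \<Omega> X" and Y_int: "\<And>m. integrable \<Omega> (Y m)"
      and conv: "(\<lambda>m. \<integral>\<omega>. \<bar>X \<omega> - Y m \<omega>\<bar> \<partial>\<Omega>) \<longlonglongrightarrow> 0"
      by (rule gamma_class_coupling[OF \<mu> \<nu>_class I_lim[unfolded I_def]]) (assumption, rule that)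
    \<comment> \<open>This \<open>\<delta>\<close> serves all \<open>Y m\<close> and all sample
      sizes at once, so one sufficiently close coupling contradicts the failure.\<close>
    obtain \<delta> where \<delta>: "\<delta> > 0"
      and le: "\<And>Y n. Y \<in> measurable \<Omega> pos_borel \<Longrightarrow> integrable \<Omega> Y \<Longrightarrow>
        (\<integral>\<omega>. \<bar>X \<omega> - Y \<omega>\<bar> \<partial>\<Omega>) < \<delta> \<Longrightarrow> n \<ge> 1 \<Longrightarrow>
        prohorov {0<..} d
          (distr (PiM UNIV (\<lambda>_::nat. distr \<Omega> pos_borel X)) pos_borel (sample_mean n))
          (distr (PiM UNIV (\<lambda>_::nat. distr \<Omega> pos_borel Y)) pos_borel (sample_mean n)) \<le> \<epsilon>"
      using prohorov_sample_mean_le[OF assms(1,3) \<Omega> X X_int \<epsilon>] by blast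
    obtain m where "(\<integral>\<omega>. \<bar>X \<omega> - Y m \<omega>\<bar> \<partial>\<Omega>) < \<delta>"
      using order_tendstoD(2)[OF conv \<delta>] by (auto simp: eventually_sequentially)
    from le[OF Y Y_int this n[of m]] show False
      using far[of m] law[OF \<mu> n[of m]] law[OF \<nu>_class n[of m]] by (simp add: X_distr Y_distr)
  qed
qed

end
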